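(* For any prime power $q\ge 3$, there exists a $q$-ary Singleton-optimal locally repairable code (with disjoint repair groups) with length \[ n=3\left\lceil\frac{7+\sqrt{8q^2-16q-7}}{6}\right\rceil, \] minimum distance $7$ and locality $2$.
   Context: Codes are linear: an $[n,k,d]_q$ code $C$ is a $k$-dimensional subspace of $\mathbb{F}_q^n$ with minimum Hamming distance $d$; $C^\perp$ is its dual code. $C$ is a locally repairable code (LRC) with locality $r$ if for every coordinate $i\in[n]=\{1,\dots,n\}$ there is a codeword $\bm h\in C^\perp$ with $i\in\mathrm{supp}(\bm h)$ and Hamming weight at most $r+1$. When $(r+1)\mid n$, $C$ has disjoint repair groups if there are $n/(r+1)$ codewords of $C^\perp$, each of Hamming weight exactly $r+1$, with pairwise disjoint supports (so the supports partition $[n]$). Convention on optimality: when $(r+1)\mid n$, an LRC is called Singleton-optimal if $n-k=\frac{n}{r+1}+d-2-\left\lfloor\frac{d-2}{r+1}\right\rfloor$. (For $d=7$, $r=2$ the usual Singleton-type bound $d\le n-k-\lceil k/r\rceil+2$ cannot be met with equality, and this equation is used instead.) Thus for $d=7$, $r=2$, $3\mid n$, Singleton-optimal means $n-k=n/3+4$. *)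

theory Defs
  imports
    "HOL.Transcendental"
    "HOL-Library.Cardinality"
    "HOL-Number_Theory.Prime_Powers"
    "Jordan_Normal_Form.VS_Connect"
begin

text \<open>
  A word of length \<open>n\<close> over the finite field \<open>'a\<close> is a vector in \<open>carrier_vec n\<close>; its
  coordinates are indexed by \<open>{..<n}\<close>.
\<close>

definition supp :: "'a::zero vec \<Rightarrow> nat set" where
  "supp v = {i. i < dim_vec v \<and> v $ i \<noteq> 0}"

definition hamming_weight :: "'a::zero vec \<Rightarrow> nat" where
  "hamming_weight v = card (supp v)"

definition hamming_distance :: "'a vec \<Rightarrow> 'a vec \<Rightarrow> nat" where
  "hamming_distance u v = card {i. i < dim_vec u \<and> u $ i \<noteq> v $ i}"

definition linear_code :: "nat \<Rightarrow> 'a::field vec set \<Rightarrow> bool" where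
  "linear_code n C \<longleftrightarrow> VectorSpace.subspace class_ring C (module_vec TYPE('a) n)"

definition code_dim :: "nat \<Rightarrow> 'a::field vec set \<Rightarrow> nat" where
  "code_dim n C = vectorspace.dim class_ring (module_vec TYPE('a) n\<lparr>carrier := C\<rparr>)"

text \<open>
  A code with a single word has no pair of distinct words. It is given minimum distance \<open>n + 1\<close>,
  the usual convention that makes the zero code an \<open>[n, 0, n + 1]\<close> code, in line with the Singleton
  bound \<open>k \<le> n - d + 1\<close> and with the description of \<open>d\<close> as the largest number such that any
  \<open>d - 1\<close> columns of a parity-check matrix are linearly independent.
\<close>

definition min_distance :: "nat \<Rightarrow> 'a vec set \<Rightarrow> nat" where
  "min_distance n C =
     (if \<exists>u\<in>C. \<exists>v\<in>C. u \<noteq> v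
      then Min {hamming_distance u v | u v. u \<in> C \<and> v \<in> C \<and> u \<noteq> v}
      else n + 1)"

definition nkd_code :: "nat \<Rightarrow> nat \<Rightarrow> nat \<Rightarrow> 'a::field vec set \<Rightarrow> bool" where
  "nkd_code n k d C \<longleftrightarrow> linear_code n C \<and> code_dim n C = k \<and> min_distance n C = d"

definition dual_code :: "nat \<Rightarrow> 'a::field vec set \<Rightarrow> 'a vec set" where
  "dual_code n C = {h \<in> carrier_vec n. \<forall>c\<in>C. h \<bullet> c = 0}"

definition has_locality :: "nat \<Rightarrow> nat \<Rightarrow> 'a::field vec set \<Rightarrow> bool" where
  "has_locality n r C \<longleftrightarrow>
     (\<forall>i<n. \<exists>h \<in> dual_code n C. i \<in> supp h \<and> hamming_weight h \<le> r + 1)"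

definition disjoint_repair_groups :: "nat \<Rightarrow> nat \<Rightarrow> 'a::field vec set \<Rightarrow> bool" where
  "disjoint_repair_groups n r C \<longleftrightarrow>
     (r + 1) dvd n \<and>
     (\<exists>H \<subseteq> dual_code n C.
        finite H \<and> card H = n div (r + 1) \<and>
        (\<forall>h\<in>H. hamming_weight h = r + 1) \<and>
        (\<forall>g\<in>H. \<forall>h\<in>H. g \<noteq> h \<longrightarrow> supp g \<inter> supp h = {}))"

text \<open>
  The equation is stated in \<open>int\<close> to avoid truncated subtraction; there \<open>div\<close> rounds down,
  as the floor in the defining equation does.
\<close>

definition singleton_optimal :: "nat \<Rightarrow> nat \<Rightarrow> nat \<Rightarrow> nat \<Rightarrow> bool" where
  "singleton_optimal n k d r \<longleftrightarrow>
     (r + 1) dvd n \<and>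
     int n - int k =
       int n div (int r + 1) + int d - 2 - (int d - 2) div (int r + 1)"

end

theory Submission
  imports Defs
begin

text \<open>
  Write \<open>n = 3m\<close>. Attach to the coordinate \<open>j\<close> a nonzero direction \<open>(u j, v j)\<close> of the plane such
  that no direction (up to scaling) is used three times, or twice inside a block of three consecutive
  coordinates. A codeword is described by one vector \<open>(a g, b g)\<close> of the plane per block \<open>g < m\<close>,
  where \<open>a\<close> and \<open>b\<close> are words of an \<open>[m, m - 2, 3]\<close> code; its coordinate \<open>j\<close> is the determinant of
  the direction of \<open>j\<close> and of the vector of the block of \<open>j\<close>. A nonzero vector gives at least two
  nonzero coordinates in its block, and only two if it is parallel to a direction of the block. At
  least three blocks are nonzero; if there are exactly three, their vectors are parallel, so they do
  not all have weight two. Geometrically, the blocks are lines of one regulus of a hyperbolic quadric,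
  each with three marked points, and a transversal of the opposite regulus meets at most two
  marked points. As there are \<open>q + 1\<close> directions, this works whenever \<open>3m \<le> 2(q + 1)\<close>, which
  covers the required length. Since \<open>3m > q + 1\<close>, some direction occurs in two blocks, and for
  \<open>m \<ge> 3\<close> its multiples on these and a third block give a word of weight exactly 7. For \<open>q = 3\<close>
  one has \<open>m = 2\<close> and the code is zero.
\<close>

section \<open>Codes as kernels of surjective linear maps\<close>

text \<open>Rank-nullity: surjectivity makes the rank \<open>r\<close>, so the dimension follows
  without exhibiting a basis. The sum form avoids truncated subtraction.\<close>

lemma kernel_code:
  fixes T :: "'a::field vec \<Rightarrow> 'a vec"
  assumes add: "\<And>v w. v \<in> carrier_vec n \<Longrightarrow> w \<in> carrier_vec n \<Longrightarrow> T (v + w) = T v + T w"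
    and smult: "\<And>c v. v \<in> carrier_vec n \<Longrightarrow> T (c \<cdot>\<^sub>v v) = c \<cdot>\<^sub>v T v"
    and surj: "T ` carrier_vec n = carrier_vec r"
  shows "linear_code n {v \<in> carrier_vec n. T v = 0\<^sub>v r}"
    and "r + code_dim n {v \<in> carrier_vec n. T v = 0\<^sub>v r} = n"
proof -
  interpret V: vec_space "TYPE('a)" n .
  interpret W: vec_space "TYPE('a)" r .
  have hom: "T \<in> module_hom class_ring (module_vec TYPE('a) n) (module_vec TYPE('a) r)"
    using surj by (auto simp: module_hom_def module_vec_simps add smult)
  interpret T: linear_map class_ring "module_vec TYPE('a) n" "module_vec TYPE('a) r" T
    unfolding linear_map_def mod_hom_def mod_hom_axioms_def
    using hom vec_vs[of n, where 'a = 'a] vec_vs[of r, where 'a = 'a]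
      vec_module[of n, where 'a = 'a] vec_module[of r, where 'a = 'a] by blast
  have ker: "T.kerT = {v \<in> carrier_vec n. T v = 0\<^sub>v r}"
    by (simp add: T.ker_def module_vec_simps)
  have im: "T.imT = carrier_vec r"
    using surj by (simp add: T.im_def module_vec_simps)
  show "linear_code n {v \<in> carrier_vec n. T v = 0\<^sub>v r}"
    unfolding linear_code_def ker[symmetric] by (rule T.kerT_is_subspace)
  have W: "(module_vec TYPE('a) r)\<lparr>carrier := carrier_vec r\<rparr> = module_vec TYPE('a) r"
    by (simp add: module_vec_def)
  show "r + code_dim n {v \<in> carrier_vec n. T v = 0\<^sub>v r} = n"
    using T.rank_nullity[OF V.fin_dim] V.dim_is_n W.dim_is_n
    unfolding ker im W code_dim_def by simp
qed

section \<open>The construction from directions and an outer code\<close>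

text \<open>Directions are compared through 2x2 determinants, so no scaling has to be chosen. As a
  block has three coordinates, \<open>block_directions\<close> also forces every direction to be
  nonzero. The values of \<open>x\<close> are the evaluation points of the outer code.\<close>

locale direction_code =
  fixes m :: nat and x u v :: "nat \<Rightarrow> 'a::field"
  assumes m_ge_2: "m \<ge> 2"
    and x_inj: "inj_on x {..<m}"
    and block_directions: "\<And>i j. i < 3 * m \<Longrightarrow> j < 3 * m \<Longrightarrow> i \<noteq> j \<Longrightarrow> i div 3 = j div 3 \<Longrightarrow>
      u i * v j \<noteq> u j * v i"
    and no_three_parallel: "\<And>i j k. i < 3 * m \<Longrightarrow> j < 3 * m \<Longrightarrow> k < 3 * m \<Longrightarrow>
      i \<noteq> j \<Longrightarrow> i \<noteq> k \<Longrightarrow> j \<noteq> k \<Longrightarrow> u i * v j = u j * v i \<Longrightarrow> u i * v k \<noteq> u k * v i"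
begin

definition entry :: "(nat \<Rightarrow> 'a) \<Rightarrow> (nat \<Rightarrow> 'a) \<Rightarrow> nat \<Rightarrow> 'a" where
  "entry a b j = u j * b (j div 3) - v j * a (j div 3)"

text \<open>A Reed-Solomon type code of redundancy 2: the parity-check matrix has rows
  \<open>1\<close> and \<open>x g\<close>. Only the values at \<open>g < m\<close> count.\<close>

definition outer :: "(nat \<Rightarrow> 'a) \<Rightarrow> bool" where
  "outer a \<longleftrightarrow> (\<Sum>g<m. a g) = 0 \<and> (\<Sum>g<m. x g * a g) = 0"

definition word :: "(nat \<Rightarrow> 'a) \<Rightarrow> (nat \<Rightarrow> 'a) \<Rightarrow> 'a vec" where
  "word a b = vec (3 * m) (entry a b)"

definition code :: "'a vec set" where
  "code = {word a b | a b. outer a \<and> outer b}"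

definition block :: "nat \<Rightarrow> nat set" where
  "block g = {j. j div 3 = g}"

lemma div_block [simp]: "Suc (3 * g) div 3 = g" "Suc (Suc (3 * g)) div 3 = g"
  by presburger+

lemma block_eq: "block g = {3 * g, 3 * g + 1, 3 * g + 2}"
  by (auto simp: block_def)

lemma card_block: "card (block g) = 3" and finite_block: "finite (block g)"
  by (simp_all add: block_eq)

lemma block_less: "g < m \<Longrightarrow> j \<in> block g \<Longrightarrow> j < 3 * m"
  by (auto simp: block_eq)

lemma x_eq_iff: "g < m \<Longrightarrow> h < m \<Longrightarrow> x g = x h \<longleftrightarrow> g = h"
  using x_inj by (auto simp: inj_on_def)

section \<open>Words of the outer code\<close>

lemma outer_restrict:
  assumes "outer a" "S \<subseteq> {..<m}" "\<And>g. g < m \<Longrightarrow> g \<notin> S \<Longrightarrow> a g = 0"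
  shows "(\<Sum>g\<in>S. a g) = 0" "(\<Sum>g\<in>S. x g * a g) = 0"
proof -
  have "(\<Sum>g\<in>S. a g) = (\<Sum>g<m. a g)" "(\<Sum>g\<in>S. x g * a g) = (\<Sum>g<m. x g * a g)"
    using assms(2,3) by (auto intro!: sum.mono_neutral_left)
  then show "(\<Sum>g\<in>S. a g) = 0" "(\<Sum>g\<in>S. x g * a g) = 0"
    using assms(1) by (simp_all add: outer_def)
qed

text \<open>Restricted to two positions the checks form an invertible Vandermonde system, so the
  outer distance is at least 3.\<close>

lemma outer_two:
  assumes "outer a" and pq: "p < m" "q < m" "p \<noteq> q"
    and "\<And>g. g < m \<Longrightarrow> g \<noteq> p \<Longrightarrow> g \<noteq> q \<Longrightarrow> a g = 0"
  shows "a p = 0" "a q = 0"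
proof -
  have s: "a p + a q = 0" "x p * a p + x q * a q = 0"
    using outer_restrict[OF assms(1), of "{p, q}"] assms by auto
  then have "a q = - a p" by (simp add: add_eq_0_iff)
  then have "(x p - x q) * a p = 0" using s(2) by (simp add: algebra_simps)
  then show "a p = 0" using x_eq_iff[of p q] pq by simp
  then show "a q = 0" using s(1) by simp
qed

text \<open>Eliminating the value at \<open>r\<close> from the two checks leaves a ratio between the
  values at \<open>p\<close> and \<open>q\<close> that depends on \<open>x\<close> only, hence is
  the same for \<open>a\<close> and \<open>b\<close>.\<close>

lemma outer_three_parallel:
  assumes "outer a" "outer b" and pqr: "p < m" "q < m" "r < m" "p \<noteq> q" "p \<noteq> r" "q \<noteq> r"
    and "\<And>g. g < m \<Longrightarrow> g \<notin> {p, q, r} \<Longrightarrow> a g = 0 \<and> b g = 0"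
  shows "a p * b q = a q * b p"
proof -
  have *: "(x p - x r) * c p = (x r - x q) * c q"
    if "outer c" "\<And>g. g < m \<Longrightarrow> g \<notin> {p, q, r} \<Longrightarrow> c g = 0" for c
  proof -
    have s: "c p + (c q + c r) = 0" "x p * c p + (x q * c q + x r * c r) = 0"
      using outer_restrict[OF that(1), of "{p, q, r}"] that(2) pqr by auto
    then have r: "c r = - c p - c q" by (simp add: add_eq_0_iff algebra_simps)
    have "(x p - x r) * c p - (x r - x q) * c q = x p * c p + (x q * c q + x r * (- c p - c q))"
      by (simp add: algebra_simps)
    also have "\<dots> = 0" using s(2) unfolding r .
    finally show ?thesis by simp
  qed
  have a: "(x p - x r) * a p = (x r - x q) * a q" and b: "(x p - x r) * b p = (x r - x q) * b q"
    using assms by (auto intro: *)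
  have "(x p - x r) * (a p * b q) = (x r - x q) * a q * b q" by (simp add: a[symmetric] mult.assoc)
  also have "\<dots> = (x p - x r) * (a q * b p)" by (simp add: b mult.left_commute mult.assoc)
  finally show ?thesis using x_eq_iff[of p r] pqr by simp
qed

lemma outer_surj: "\<exists>a :: nat \<Rightarrow> 'a. (\<Sum>g<m. a g) = s \<and> (\<Sum>g<m. x g * a g) = t"
proof -
  have d: "x 1 - x 0 \<noteq> 0" using x_eq_iff[of 1 0] m_ge_2 by simp
  \<comment> \<open>The solution of \<open>x 0 * (s - z) + x 1 * z = t\<close>: positions 0 and 1
    alone realise any pair of check values.\<close>
  define z where "z = (t - x 0 * s) / (x 1 - x 0)"
  define a :: "nat \<Rightarrow> 'a" where "a = (\<lambda>g. if g = 0 then s - z else if g = 1 then z else 0)"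
  have "(\<Sum>g<m. f g * a g) = (\<Sum>g\<in>{0, 1}. f g * a g)" for f :: "nat \<Rightarrow> 'a"
    using m_ge_2 by (intro sum.mono_neutral_right) (auto simp: a_def)
  then have sum: "(\<Sum>g<m. f g * a g) = f 0 * (s - z) + f 1 * z" for f :: "nat \<Rightarrow> 'a"
    by (simp add: a_def)
  have "(x 1 - x 0) * z = t - x 0 * s" using d by (simp add: z_def)
  then have "(\<Sum>g<m. x g * a g) = t" unfolding sum by (simp add: algebra_simps)
  moreover have "(\<Sum>g<m. a g) = s" using sum[of "\<lambda>_. 1"] by simp
  ultimately show ?thesis by blast
qed

section \<open>Weights inside a block and the lower bound 7\<close>

text \<open>Two zero entries are a homogeneous 2x2 system for the block vector, whose determinant is
  nonzero because the directions differ.\<close>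

lemma two_zeros_in_block:
  assumes "g < m" "i \<in> block g" "j \<in> block g" "i \<noteq> j" "entry a b i = 0" "entry a b j = 0"
  shows "a g = 0" "b g = 0"
proof -
  have d: "u i * v j - u j * v i \<noteq> 0"
    using assms block_less block_directions[of i j] by (simp add: block_def)
  have e: "u i * b g = v i * a g" "u j * b g = v j * a g"
    using assms by (auto simp: entry_def block_def)
  have "(u i * v j - u j * v i) * b g = (u i * b g) * v j - (u j * b g) * v i"
    by (simp add: algebra_simps)
  also have "\<dots> = 0" unfolding e by (simp add: algebra_simps)
  finally show "b g = 0" using d by simp
  have "(u i * v j - u j * v i) * a g = u i * (v j * a g) - u j * (v i * a g)"
    by (simp add: algebra_simps)
  also have "\<dots> = 0" unfolding e[symmetric] by (simp add: algebra_simps)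
  finally show "a g = 0" using d by simp
qed

lemma supp_word: "supp (word a b) = (\<Union>g<m. {j \<in> block g. entry a b j \<noteq> 0})"
  by (auto simp: supp_def word_def block_def)

lemma card_nonzero_in_block:
  assumes "g < m" "a g \<noteq> 0 \<or> b g \<noteq> 0"
  shows "card {j \<in> block g. entry a b j \<noteq> 0} \<ge> 2"
    and "card {j \<in> block g. entry a b j \<noteq> 0} = 2 \<Longrightarrow> \<exists>j\<in>block g. entry a b j = 0"
proof -
  let ?Z = "{j \<in> block g. entry a b j = 0}"
  have "i = j" if "i \<in> ?Z" "j \<in> ?Z" for i j
    using two_zeros_in_block[OF assms(1), of i j a b] assms(2) that by auto
  then have "card ?Z \<le> 1" using finite_block by (simp add: card_le_Suc0_iff_eq)
  moreover have "{j \<in> block g. entry a b j \<noteq> 0} = block g - ?Z" by auto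
  then have c: "card {j \<in> block g. entry a b j \<noteq> 0} = 3 - card ?Z"
    using card_block finite_block by (simp add: card_Diff_subset)
  ultimately show "card {j \<in> block g. entry a b j \<noteq> 0} \<ge> 2" by simp
  assume "card {j \<in> block g. entry a b j \<noteq> 0} = 2"
  then have "?Z \<noteq> {}" using c by (metis card.empty diff_zero numeral_eq_iff semiring_norm(89))
  then show "\<exists>j\<in>block g. entry a b j = 0" by blast
qed

text \<open>A zero entry makes the direction parallel to the block vector, and parallelism passes
  through nonzero vectors. To avoid case distinctions, the determinant of the directions is shown to
  be killed by both \<open>a p * a q\<close> and \<open>b p * b q\<close>, which cannot both
  vanish.\<close>

lemma zero_entries_parallel:
  assumes "entry a b i = 0" "entry a b j = 0"
    and "a (i div 3) \<noteq> 0 \<or> b (i div 3) \<noteq> 0" "a (j div 3) \<noteq> 0 \<or> b (j div 3) \<noteq> 0"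
    and "a (i div 3) * b (j div 3) = a (j div 3) * b (i div 3)"
  shows "u i * v j = u j * v i"
proof -
  define p q where "p = i div 3" and "q = j div 3"
  note defs = p_def[symmetric] q_def[symmetric]
  have e: "u i * b p = v i * a p" "u j * b q = v j * a q"
    using assms(1,2) by (simp_all add: entry_def defs)
  have par: "a p * b q = a q * b p" using assms(5) by (simp add: defs)
  have a: "(u i * v j - u j * v i) * (a p * a q) = 0"
  proof -
    have "(u i * v j - u j * v i) * (a p * a q) = u i * a p * (v j * a q) - u j * a q * (v i * a p)"
      by (simp add: algebra_simps)
    also have "\<dots> = u i * u j * (a p * b q - a q * b p)"
      unfolding e[symmetric] by (simp add: algebra_simps)
    finally show ?thesis using par by simp
  qed
  have b: "(u i * v j - u j * v i) * (b p * b q) = 0"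
  proof -
    have "(u i * v j - u j * v i) * (b p * b q) = (u i * b p) * v j * b q - (u j * b q) * v i * b p"
      by (simp add: algebra_simps)
    also have "\<dots> = v i * v j * (a p * b q - a q * b p)"
      unfolding e by (simp add: algebra_simps)
    finally show ?thesis using par by simp
  qed
  have nz: "a p \<noteq> 0 \<or> b p \<noteq> 0" "a q \<noteq> 0 \<or> b q \<noteq> 0" using assms(3,4) by (simp_all add: defs)
  have "a p * a q \<noteq> 0 \<or> b p * b q \<noteq> 0"
    using nz par by (metis mult_eq_0_iff)
  with a b show ?thesis by auto
qed

lemma weight_ge_7:
  assumes "outer a" "outer b" "g < m" "a g \<noteq> 0 \<or> b g \<noteq> 0"
  shows "hamming_weight (word a b) \<ge> 7"
proof -
  define S where "S = {g. g < m \<and> (a g \<noteq> 0 \<or> b g \<noteq> 0)}"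
  define N where "N g = {j \<in> block g. entry a b j \<noteq> 0}" for g
  have S: "finite S" "S \<subseteq> {..<m}" "S \<noteq> {}" using assms by (auto simp: S_def)
  have off_S: "a g = 0 \<and> b g = 0" if "g < m" "g \<notin> S" for g using that by (auto simp: S_def)
  have "card S \<ge> 3"
  proof (rule ccontr)
    assume "\<not> card S \<ge> 3"
    \<comment> \<open>Enlarging \<open>S\<close> to exactly two blocks, possible as
      \<open>m \<ge> 2\<close>, treats all small sizes at once.\<close>
    then obtain P where P: "S \<subseteq> P" "P \<subseteq> {..<m}" "card P = 2"
      using exists_subset_between[of S 2 "{..<m}"] S m_ge_2 by auto
    then obtain p q where pq: "P = {p, q}" "p \<noteq> q" by (auto simp: card_2_iff)
    have "a p = 0 \<and> a q = 0 \<and> b p = 0 \<and> b q = 0"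
      using outer_two[OF assms(1), of p q] outer_two[OF assms(2), of p q] P pq off_S by auto
    then have "S \<inter> P = {}" unfolding S_def pq by auto
    then show False using P S by blast
  qed
  have "(\<Union>g\<in>S. N g) \<subseteq> supp (word a b)"
    using S by (auto simp: supp_word N_def)
  moreover have "finite (supp (word a b))" by (simp add: supp_def)
  ultimately have "card (\<Union>g\<in>S. N g) \<le> hamming_weight (word a b)"
    unfolding hamming_weight_def by (rule card_mono[rotated])
  also have "card (\<Union>g\<in>S. N g) = (\<Sum>g\<in>S. card (N g))"
    using S finite_block by (intro card_UN_disjoint) (auto simp: N_def block_def)
  finally have le: "(\<Sum>g\<in>S. card (N g)) \<le> hamming_weight (word a b)" .
  have N2: "card (N g) \<ge> 2" if "g \<in> S" for g
    using card_nonzero_in_block(1)[of g a b] that by (auto simp: N_def S_def)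
  show ?thesis
  proof (cases "card S = 3")
    case False
    \<comment> \<open>At least four nonzero blocks, each of weight at least 2.\<close>
    then have "8 \<le> (\<Sum>g\<in>S. 2 :: nat)" using \<open>card S \<ge> 3\<close> by simp
    also have "\<dots> \<le> (\<Sum>g\<in>S. card (N g))" using N2 by (rule sum_mono)
    finally show ?thesis using le by simp
  next
    case True
    then obtain p q r where pqr: "S = {p, q, r}" "p \<noteq> q" "p \<noteq> r" "q \<noteq> r"
      by (auto simp: card_3_iff)
    have in_S: "p \<in> S" "q \<in> S" "r \<in> S" by (simp_all add: pqr)
    show ?thesis
    proof (rule ccontr)
      assume "\<not> ?thesis"
      \<comment> \<open>Weight at most 6 forces a zero in each of the three blocks; their directions
        are then all parallel, against \<open>no_three_parallel\<close>.\<close>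
      then have "card (N p) + card (N q) + card (N r) \<le> 6" using le pqr by simp
      then have "card (N p) = 2" "card (N q) = 2" "card (N r) = 2"
        using N2[OF in_S(1)] N2[OF in_S(2)] N2[OF in_S(3)] by linarith+
      then have "\<exists>i\<in>block p. entry a b i = 0" "\<exists>j\<in>block q. entry a b j = 0"
        "\<exists>k\<in>block r. entry a b k = 0"
        using card_nonzero_in_block(2)[of _ a b] in_S unfolding N_def S_def by simp_all
      then obtain i j k where ijk: "i \<in> block p" "j \<in> block q" "k \<in> block r"
        "entry a b i = 0" "entry a b j = 0" "entry a b k = 0"
        by blast
      have less: "p < m" "q < m" "r < m" using in_S S by auto
      have "a p * b q = a q * b p" "a p * b r = a r * b p"
        using outer_three_parallel[OF assms(1,2), of p q r]
          outer_three_parallel[OF assms(1,2), of p r q] less pqr off_S by auto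
      then have "u i * v j = u j * v i" "u i * v k = u k * v i"
        using zero_entries_parallel[of a b i j] zero_entries_parallel[of a b i k] ijk in_S
        by (auto simp: block_def S_def)
      then show False
        using no_three_parallel[of i j k] ijk pqr less block_less by (auto simp: block_def)
    qed
  qed
qed

section \<open>The minimum distance\<close>

lemma code_carrier: "c \<in> code \<Longrightarrow> c \<in> carrier_vec (3 * m)"
  by (auto simp: code_def word_def)

lemma outer_diff: "outer a \<Longrightarrow> outer b \<Longrightarrow> outer (\<lambda>g. a g - b g)"
  by (simp add: outer_def sum_subtractf right_diff_distrib)

lemma distance_ge_7:
  assumes "c \<in> code" "d \<in> code" "c \<noteq> d"
  shows "hamming_distance c d \<ge> 7"
proof -
  obtain a b a' b' where c: "c = word a b" "outer a" "outer b" and d: "d = word a' b'" "outer a'" "outer b'"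
    using assms by (auto simp: code_def)
  let ?a = "\<lambda>g. a g - a' g" and ?b = "\<lambda>g. b g - b' g"
  have diff: "entry ?a ?b j = entry a b j - entry a' b' j" for j
    by (simp add: entry_def right_diff_distrib)
  have "hamming_distance c d = hamming_weight (word ?a ?b)"
    unfolding hamming_distance_def hamming_weight_def supp_def c d word_def
    by (rule arg_cong[where f = card]) (auto simp: diff)
  moreover have "\<exists>g<m. ?a g \<noteq> 0 \<or> ?b g \<noteq> 0"
  proof (rule ccontr)
    assume "\<not> ?thesis"
    then have "a (j div 3) = a' (j div 3) \<and> b (j div 3) = b' (j div 3)" if "j < 3 * m" for j
      using that by auto
    then have "c = d" unfolding c d word_def by (intro eq_vecI) (simp_all add: entry_def)
    then show False using assms by simp
  qed
  then obtain g where "g < m" "?a g \<noteq> 0 \<or> ?b g \<noteq> 0" by blast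
  ultimately show ?thesis
    using weight_ge_7[OF outer_diff outer_diff, of a a' b b' g] c d by simp
qed

text \<open>All three block vectors are multiples of the direction shared by \<open>i\<close> and
  \<open>j\<close>, so the nine coordinates of these blocks lose at least the two at
  \<open>i\<close> and \<open>j\<close>; \<open>weight_ge_7\<close> excludes further zeros.\<close>

lemma weight_7_word:
  assumes "m \<ge> 3" and ij: "i < 3 * m" "j < 3 * m" "i div 3 \<noteq> j div 3" "u i * v j = u j * v i"
  shows "\<exists>a b. outer a \<and> outer b \<and> hamming_weight (word a b) = 7"
proof -
  define p q where "p = i div 3" and "q = j div 3"
  have pq: "p < m" "q < m" "p \<noteq> q" using ij by (auto simp: p_def q_def)
  have "{..<m} - {p, q} \<noteq> {}"
  proof
    assume "{..<m} - {p, q} = {}"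
    then have "m \<le> card {p, q}" using card_mono[of "{p, q}" "{..<m}"] by auto
    then show False using assms(1) pq by simp
  qed
  then obtain r where r: "r < m" "r \<noteq> p" "r \<noteq> q" by auto
  \<comment> \<open>Up to sign, the cross product of \<open>(1, 1, 1)\<close> and
    \<open>(x p, x q, x r)\<close>: an outer word of weight 3.\<close>
  define l where "l = (\<lambda>g. if g = p then x q - x r else if g = q then x r - x p
    else if g = r then x p - x q else 0)"
  have "(\<Sum>g<m. f g * l g) = (\<Sum>g\<in>{p, q, r}. f g * l g)" for f :: "nat \<Rightarrow> 'a"
    using pq r by (intro sum.mono_neutral_right) (auto simp: l_def)
  then have sum: "(\<Sum>g<m. f g * l g) = f p * (x q - x r) + (f q * (x r - x p) + f r * (x p - x q))"
    for f :: "nat \<Rightarrow> 'a"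
    using pq r by (simp add: l_def)
  have scaled: "outer (\<lambda>g. l g * c)" for c
    using sum[of "\<lambda>_. c"] sum[of "\<lambda>g. x g * c"] by (simp add: outer_def algebra_simps)
  let ?a = "\<lambda>g. l g * u i" and ?b = "\<lambda>g. l g * v i"
  let ?w = "word ?a ?b"
  \<comment> \<open>The word must be nonzero for the lower bound to apply; a zero direction would
    have determinant 0 with its neighbour \<open>i'\<close>.\<close>
  have "u i \<noteq> 0 \<or> v i \<noteq> 0"
  proof -
    define i' where "i' = (if i = 3 * p then 3 * p + 1 else 3 * p)"
    have "i' \<in> block p" "i' \<noteq> i" by (auto simp: i'_def block_eq)
    then have "i' < 3 * m" "i' div 3 = i div 3" using block_less pq by (auto simp: block_def p_def)
    then show ?thesis
      using block_directions[of i i'] ij(1) \<open>i' \<noteq> i\<close> by auto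
  qed
  moreover have "l p \<noteq> 0" using x_eq_iff pq r by (simp add: l_def)
  ultimately have "hamming_weight ?w \<ge> 7"
    using weight_ge_7[OF scaled scaled pq(1)] by simp
  moreover have "entry ?a ?b i = 0" "entry ?a ?b j = 0"
    using ij(4) by (simp_all add: entry_def algebra_simps)
  then have "supp ?w \<subseteq> (block p \<union> block q \<union> block r) - {i, j}"
    by (auto simp: supp_word entry_def block_def) (auto simp: l_def split: if_splits)
  then have "card (supp ?w) \<le> card ((block p \<union> block q \<union> block r) - {i, j})"
    using finite_block by (intro card_mono) auto
  moreover have "card ((block p \<union> block q \<union> block r) - {i, j}) = 7"
  proof -
    have "card (block p \<union> block q \<union> block r) = 9"
    proof -
      have "block p \<inter> block q = {}" "(block p \<union> block q) \<inter> block r = {}"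
        using pq r by (auto simp: block_def)
      then show ?thesis using finite_block by (simp add: card_Un_disjoint card_block)
    qed
    moreover have "{i, j} \<subseteq> block p \<union> block q \<union> block r" by (auto simp: block_def p_def q_def)
    moreover have "card {i, j} = 2" using ij by (auto simp: card_2_iff)
    ultimately show ?thesis by (simp add: card_Diff_subset)
  qed
  ultimately have "hamming_weight ?w = 7" by (simp add: hamming_weight_def)
  then show ?thesis using scaled by blast
qed

lemma min_distance_code:
  assumes "m = 2 \<or> (\<exists>i j. m \<ge> 3 \<and> i < 3 * m \<and> j < 3 * m \<and> i div 3 \<noteq> j div 3 \<and> u i * v j = u j * v i)"
  shows "min_distance (3 * m) code = 7"
proof -
  have le: "hamming_distance c d \<le> 3 * m" if "c \<in> code" for c d
    using card_mono[of "{..<3 * m}" "{i. i < dim_vec c \<and> c $ i \<noteq> d $ i}"] code_carrier[OF that]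
    by (auto simp: hamming_distance_def)
  show ?thesis
    using assms
  proof (elim disjE exE conjE)
    assume "m = 2"
    \<comment> \<open>Length 6 leaves no room for distance 7, so the code is trivial and the
      convention \<open>n + 1\<close> yields 7.\<close>
    have "c = d" if "c \<in> code" "d \<in> code" for c d
      using le[of c d] distance_ge_7[of c d] that \<open>m = 2\<close> by linarith
    then have "\<not> (\<exists>c\<in>code. \<exists>d\<in>code. c \<noteq> d)" by blast
    then show ?thesis using \<open>m = 2\<close> by (simp add: min_distance_def)
  next
    fix i j
    assume "m \<ge> 3" "i < 3 * m" "j < 3 * m" "i div 3 \<noteq> j div 3" "u i * v j = u j * v i"
    then obtain a b where ab: "outer a" "outer b" "hamming_weight (word a b) = 7"
      using weight_7_word by blast
    let ?z = "word (\<lambda>_. 0) (\<lambda>_. 0)"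
    have "outer (\<lambda>_. 0)" by (simp add: outer_def)
    then have in_code: "word a b \<in> code" "?z \<in> code" using ab by (auto simp: code_def)
    have dist: "hamming_distance (word a b) ?z = 7"
      unfolding ab(3)[symmetric] hamming_distance_def hamming_weight_def supp_def word_def
      by (rule arg_cong[where f = card]) (auto simp: entry_def[of "\<lambda>_. 0" "\<lambda>_. 0"])
    then have ne: "word a b \<noteq> ?z" by (auto simp: hamming_distance_def)
    let ?D = "{hamming_distance c d | c d. c \<in> code \<and> d \<in> code \<and> c \<noteq> d}"
    have "Min ?D = 7"
    proof (rule Min_eqI)
      show "finite ?D" using le by (intro finite_subset[of ?D "{..3 * m}"]) auto
      show "7 \<in> ?D" unfolding mem_Collect_eq
        by (intro exI[of _ "word a b"] exI[of _ ?z]) (simp add: dist in_code ne)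
    qed (use distance_ge_7 in auto)
    then show ?thesis using in_code ne unfolding min_distance_def by auto
  qed
qed

section \<open>Repair groups\<close>

text \<open>The coefficients of the linear relation among the three plane vectors
  \<open>(u j, v j)\<close> of a block, given by 2x2 minors. They are nonzero since the directions
  are pairwise non-parallel.\<close>

definition check :: "nat \<Rightarrow> 'a vec" where
  "check g = vec (3 * m) (\<lambda>j.
     if j = 3 * g then u (3 * g + 1) * v (3 * g + 2) - u (3 * g + 2) * v (3 * g + 1)
     else if j = 3 * g + 1 then u (3 * g + 2) * v (3 * g) - u (3 * g) * v (3 * g + 2)
     else if j = 3 * g + 2 then u (3 * g) * v (3 * g + 1) - u (3 * g + 1) * v (3 * g)
     else 0)"

lemma supp_check: "g < m \<Longrightarrow> supp (check g) = block g"
  using block_directions[of "3 * g" "3 * g + 1"] block_directions[of "3 * g + 1" "3 * g + 2"]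
    block_directions[of "3 * g + 2" "3 * g"]
  by (auto simp: supp_def check_def block_eq split: if_splits)

text \<open>Inside a block \<open>entry\<close> is linear in the direction, so the relation among
  the directions carries over to the entries.\<close>

lemma check_dual:
  assumes "g < m"
  shows "check g \<in> dual_code (3 * m) code"
proof -
  have "check g \<bullet> word a b = 0" for a b
  proof -
    have "check g \<bullet> word a b = (\<Sum>j<3 * m. check g $ j * entry a b j)"
      by (simp add: scalar_prod_def word_def lessThan_atLeast0)
    also have "\<dots> = (\<Sum>j\<in>block g. check g $ j * entry a b j)"
      using assms block_less by (intro sum.mono_neutral_right) (auto simp: check_def block_eq)
    also have "\<dots> = 0"
      using assms by (simp add: block_eq check_def entry_def) (simp add: algebra_simps)
    finally show ?thesis .
  qed
  then show ?thesis by (auto simp: dual_code_def code_def check_def)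
qed

lemma has_locality_code: "has_locality (3 * m) 2 code"
  unfolding has_locality_def
proof (intro allI impI)
  fix i assume "i < 3 * m"
  then have g: "i div 3 < m" by auto
  then show "\<exists>h\<in>dual_code (3 * m) code. i \<in> supp h \<and> hamming_weight h \<le> 2 + 1"
    using check_dual[OF g] supp_check[OF g] card_block
    by (intro bexI[of _ "check (i div 3)"]) (auto simp: hamming_weight_def block_def)
qed

lemma disjoint_repair_groups_code: "disjoint_repair_groups (3 * m) 2 code"
proof -
  have "inj_on check {..<m}"
  proof (rule inj_onI)
    fix g h assume "g \<in> {..<m}" "h \<in> {..<m}" "check g = check h"
    then have "block g = block h" using supp_check[of g] supp_check[of h] by simp
    then have "3 * g \<in> block h" by (auto simp: block_eq)
    then show "g = h" by (simp add: block_def)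
  qed
  then have "card (check ` {..<m}) = m" by (simp add: card_image)
  then show ?thesis
    unfolding disjoint_repair_groups_def
    using check_dual supp_check card_block
    by (intro conjI exI[of _ "check ` {..<m}"]) (auto simp: hamming_weight_def block_def)
qed

section \<open>The dimension, by a syndrome map\<close>

text \<open>
  The vector of block \<open>g\<close>, recovered from the first two coordinates of the block by Cramer's rule.
\<close>

definition rec_a :: "'a vec \<Rightarrow> nat \<Rightarrow> 'a" where
  "rec_a c g = (c $ (3 * g) * u (3 * g + 1) - c $ (3 * g + 1) * u (3 * g))
     / (u (3 * g) * v (3 * g + 1) - u (3 * g + 1) * v (3 * g))"

definition rec_b :: "'a vec \<Rightarrow> nat \<Rightarrow> 'a" where
  "rec_b c g = (c $ (3 * g) * v (3 * g + 1) - c $ (3 * g + 1) * v (3 * g))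
     / (u (3 * g) * v (3 * g + 1) - u (3 * g + 1) * v (3 * g))"

text \<open>A parity-check map with exactly the \<open>m + 4\<close> checks that optimality
  prescribes: one per block for consistency of its third coordinate, and two outer checks for each
  component of the block vectors.\<close>

definition syndrome :: "'a vec \<Rightarrow> 'a vec" where
  "syndrome c = vec (m + 4) (\<lambda>i.
     if i < m then c $ (3 * i + 2) - entry (rec_a c) (rec_b c) (3 * i + 2)
     else if i = m then \<Sum>g<m. rec_a c g
     else if i = m + 1 then \<Sum>g<m. x g * rec_a c g
     else if i = m + 2 then \<Sum>g<m. rec_b c g
     else \<Sum>g<m. x g * rec_b c g)"

lemma det_nonzero:
  "g < m \<Longrightarrow> u (3 * g) * v (3 * g + 1) - u (3 * g + 1) * v (3 * g) \<noteq> 0"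
  using block_directions[of "3 * g" "3 * g + 1"] by simp

lemma rec_entry:
  assumes "g < m" "c $ (3 * g) = entry a b (3 * g)" "c $ (3 * g + 1) = entry a b (3 * g + 1)"
  shows "rec_a c g = a g" "rec_b c g = b g"
  unfolding rec_a_def rec_b_def assms(2,3) entry_def
  using det_nonzero[OF assms(1)] by (simp_all add: nonzero_divide_eq_eq) (simp_all add: algebra_simps)

lemma entry_rec:
  assumes "g < m"
  shows "entry (rec_a c) (rec_b c) (3 * g) = c $ (3 * g)"
    and "entry (rec_a c) (rec_b c) (3 * g + 1) = c $ (3 * g + 1)"
proof -
  define d where "d = u (3 * g) * v (3 * g + 1) - u (3 * g + 1) * v (3 * g)"
  have d: "d \<noteq> 0" using det_nonzero[OF assms] by (simp add: d_def)
  have ab: "rec_a c g * d = c $ (3 * g) * u (3 * g + 1) - c $ (3 * g + 1) * u (3 * g)"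
    "rec_b c g * d = c $ (3 * g) * v (3 * g + 1) - c $ (3 * g + 1) * v (3 * g)"
    using d by (simp_all add: rec_a_def rec_b_def d_def)
  have "entry (rec_a c) (rec_b c) (3 * g) * d = u (3 * g) * (rec_b c g * d) - v (3 * g) * (rec_a c g * d)"
    by (simp add: entry_def algebra_simps)
  also have "\<dots> = c $ (3 * g) * d" unfolding ab by (simp add: d_def algebra_simps)
  finally show "entry (rec_a c) (rec_b c) (3 * g) = c $ (3 * g)" using d by simp
  have "entry (rec_a c) (rec_b c) (3 * g + 1) * d
      = u (3 * g + 1) * (rec_b c g * d) - v (3 * g + 1) * (rec_a c g * d)"
    by (simp add: entry_def) (simp add: algebra_simps)
  also have "\<dots> = c $ (3 * g + 1) * d" unfolding ab by (simp add: d_def algebra_simps)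
  finally show "entry (rec_a c) (rec_b c) (3 * g + 1) = c $ (3 * g + 1)" using d by simp
qed

lemma syndrome_zero_iff:
  assumes "c \<in> carrier_vec (3 * m)"
  shows "syndrome c = 0\<^sub>v (m + 4) \<longleftrightarrow>
    (\<forall>g<m. c $ (3 * g + 2) = entry (rec_a c) (rec_b c) (3 * g + 2)) \<and> outer (rec_a c) \<and> outer (rec_b c)"
    (is "?l \<longleftrightarrow> ?r")
proof
  assume l: ?l
  have *: "syndrome c $ i = 0" if "i < m + 4" for i using l that by simp
  have "c $ (3 * g + 2) = entry (rec_a c) (rec_b c) (3 * g + 2)" if "g < m" for g
    using *[of g] that by (simp add: syndrome_def)
  moreover have "outer (rec_a c)" "outer (rec_b c)"
    using *[of m] *[of "m + 1"] *[of "m + 2"] *[of "m + 3"]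
    by (simp_all add: syndrome_def outer_def)
  ultimately show ?r by blast
next
  assume ?r
  then show ?l by (intro eq_vecI) (auto simp: syndrome_def outer_def)
qed

lemma block_cases:
  assumes "j < 3 * m"
  obtains g where "g < m" "j = 3 * g" | g where "g < m" "j = 3 * g + 1" | g where "g < m" "j = 3 * g + 2"
proof -
  have "j div 3 < m" "j \<in> block (j div 3)" using assms by (auto simp: block_def)
  then show thesis using that unfolding block_eq by blast
qed

lemma code_eq_kernel: "code = {c \<in> carrier_vec (3 * m). syndrome c = 0\<^sub>v (m + 4)}"
proof (intro equalityI subsetI)
  fix c assume "c \<in> code"
  then obtain a b where c: "c = word a b" "outer a" "outer b" by (auto simp: code_def)
  have "rec_a c g = a g \<and> rec_b c g = b g" if "g < m" for g
    using rec_entry[OF that, of c a b] that by (simp add: c word_def)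
  then have "outer (rec_a c)" "outer (rec_b c)"
    "\<forall>g<m. c $ (3 * g + 2) = entry (rec_a c) (rec_b c) (3 * g + 2)"
    using c by (auto simp: outer_def word_def entry_def)
  then show "c \<in> {c \<in> carrier_vec (3 * m). syndrome c = 0\<^sub>v (m + 4)}"
    using syndrome_zero_iff[of c] code_carrier[OF \<open>c \<in> code\<close>] by auto
next
  fix c assume c: "c \<in> {c \<in> carrier_vec (3 * m). syndrome c = 0\<^sub>v (m + 4)}"
  then have out: "outer (rec_a c)" "outer (rec_b c)"
    and last: "\<forall>g<m. c $ (3 * g + 2) = entry (rec_a c) (rec_b c) (3 * g + 2)"
    using syndrome_zero_iff[of c] by auto
  have "c $ j = entry (rec_a c) (rec_b c) j" if "j < 3 * m" for j
    using that by (rule block_cases) (use entry_rec last in auto)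
  then have "c = word (rec_a c) (rec_b c)" using c by (auto simp: word_def)
  then show "c \<in> code" using out by (auto simp: code_def)
qed

lemma syndrome_surj: "syndrome ` carrier_vec (3 * m) = carrier_vec (m + 4)"
proof (intro equalityI subsetI)
  fix s :: "'a vec" assume s: "s \<in> carrier_vec (m + 4)"
  obtain a where a: "(\<Sum>g<m. a g) = s $ m" "(\<Sum>g<m. x g * a g) = s $ (m + 1)"
    using outer_surj by blast
  obtain b where b: "(\<Sum>g<m. b g) = s $ (m + 2)" "(\<Sum>g<m. x g * b g) = s $ (m + 3)"
    using outer_surj by blast
  \<comment> \<open>Shifting only the third coordinate of each block sets the block checks freely:
    \<open>rec_a\<close> and \<open>rec_b\<close> read the first two coordinates and still return
    \<open>a\<close> and \<open>b\<close>.\<close>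
  define c where "c = vec (3 * m) (\<lambda>j. entry a b j + (if j mod 3 = 2 then s $ (j div 3) else 0))"
  have rec: "rec_a c g = a g" "rec_b c g = b g" if "g < m" for g
    using rec_entry[OF that, of c a b] that by (simp_all add: c_def mod_Suc)
  have "syndrome c $ i = s $ i" if i: "i < m + 4" for i
  proof -
    consider "i < m" | "i = m" | "i = m + 1" | "i = m + 2" | "i = m + 3" using i by linarith
    then show ?thesis
    proof cases
      case 1
      have "(3 * i + 2) mod 3 = 2" "(3 * i + 2) div 3 = i" by presburger+
      then show ?thesis
        using 1 rec[of i] by (simp add: syndrome_def c_def entry_def)
    qed (use rec a b in \<open>simp_all add: syndrome_def\<close>)
  qed
  then have "syndrome c = s" using s by (auto simp: syndrome_def)
  moreover have "c \<in> carrier_vec (3 * m)" by (simp add: c_def)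
  ultimately show "s \<in> syndrome ` carrier_vec (3 * m)" by blast
qed (auto simp: syndrome_def)

lemma rec_add:
  assumes "c \<in> carrier_vec (3 * m)" "d \<in> carrier_vec (3 * m)" "g < m"
  shows "rec_a (c + d) g = rec_a c g + rec_a d g" "rec_b (c + d) g = rec_b c g + rec_b d g"
  using assms by (simp_all add: rec_a_def rec_b_def algebra_simps flip: add_divide_distrib)

lemma rec_smult:
  assumes "c \<in> carrier_vec (3 * m)" "g < m"
  shows "rec_a (t \<cdot>\<^sub>v c) g = t * rec_a c g" "rec_b (t \<cdot>\<^sub>v c) g = t * rec_b c g"
  using assms by (simp_all add: rec_a_def rec_b_def algebra_simps)

lemma syndrome_add:
  assumes "c \<in> carrier_vec (3 * m)" "d \<in> carrier_vec (3 * m)"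
  shows "syndrome (c + d) = syndrome c + syndrome d"
  using assms
  by (intro eq_vecI) (auto simp: syndrome_def entry_def rec_add sum.distrib algebra_simps)

lemma syndrome_smult:
  assumes "c \<in> carrier_vec (3 * m)"
  shows "syndrome (t \<cdot>\<^sub>v c) = t \<cdot>\<^sub>v syndrome c"
  using assms
  by (intro eq_vecI) (auto simp: syndrome_def entry_def rec_smult sum_distrib_left algebra_simps)

lemma linear_code_code: "linear_code (3 * m) code"
  and code_dim_code: "m + 4 + code_dim (3 * m) code = 3 * m"
  unfolding code_eq_kernel
  using kernel_code[OF syndrome_add syndrome_smult syndrome_surj] by auto

lemma optimal_code:
  assumes "m = 2 \<or> (\<exists>i j. m \<ge> 3 \<and> i < 3 * m \<and> j < 3 * m \<and> i div 3 \<noteq> j div 3 \<and> u i * v j = u j * v i)"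
  shows "\<exists>k. nkd_code (3 * m) k 7 code \<and> has_locality (3 * m) 2 code \<and>
    disjoint_repair_groups (3 * m) 2 code \<and> singleton_optimal (3 * m) k 7 2"
proof (intro exI conjI)
  show "nkd_code (3 * m) (code_dim (3 * m) code) 7 code"
    using linear_code_code min_distance_code[OF assms] by (simp add: nkd_code_def)
  \<comment> \<open>Here \<open>5 div 3 = 1\<close>, so the required redundancy is
    \<open>m + 7 - 2 - 1 = m + 4\<close>.\<close>
  show "singleton_optimal (3 * m) (code_dim (3 * m) code) 7 2"
    using code_dim_code by (simp add: singleton_optimal_def)
qed (rule has_locality_code disjoint_repair_groups_code)+

end

section \<open>Numerical bounds on the number of blocks\<close>

text \<open>With \<open>q + 1\<close> directions, the upper bound on \<open>3 * m\<close> lets each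
  be used at most twice and the strict lower bound forces a repetition; \<open>m \<ge> 3\<close>
  supplies the third block of a word of weight 7.\<close>

lemma block_count_bounds:
  fixes m q :: nat
  assumes "q \<ge> 3" and "int m = \<lceil>(7 + sqrt (8 * real q ^ 2 - 16 * real q - 7)) / 6\<rceil>"
  shows "m \<ge> 2" "3 * m \<le> 2 * q + 2" "q + 1 < 3 * m" "q \<ge> 4 \<Longrightarrow> m \<ge> 3"
proof -
  define s where "s = sqrt (8 * real q ^ 2 - 16 * real q - 7)"
  have "real m \<ge> (7 + s) / 6" "real m < (7 + s) / 6 + 1"
    using assms(2) unfolding s_def by linarith+
  then have m: "6 * real m \<ge> 7 + s" "6 * real m < 13 + s" by (simp_all add: field_simps)
  have q: "real q \<ge> 3" using assms(1) by simp
  have nonneg: "8 * real q ^ 2 - 16 * real q - 7 \<ge> 0"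
  proof -
    have "8 * real q ^ 2 - 16 * real q - 7 = 8 * (real q - 3) * (real q + 1) + 17"
      by (simp add: power2_eq_square algebra_simps)
    then show ?thesis using q by simp
  qed
  then have s: "s \<ge> 0" "s ^ 2 = 8 * real q ^ 2 - 16 * real q - 7" by (simp_all add: s_def)
  have "real m > 1" using m(1) s(1) by simp
  then show "m \<ge> 2" by simp
  show "3 * m \<le> 2 * q + 2"
  proof (rule ccontr)
    assume "\<not> ?thesis"
    then have "real (2 * q + 3) \<le> real (3 * m)" by (subst of_nat_le_iff) simp
    then have "2 * real q + 3 \<le> 3 * real m" by simp
    \<comment> \<open>From \<open>4 * q + 6 \<le> 6 * m < 13 + s\<close>; squaring gives
      \<open>8 * q^2 - 40 * q + 56 \<le> 0\<close>, and half of the left side is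
      \<open>(2 * q - 5)^2 + 3\<close>.\<close>
    then have "4 * real q - 7 \<le> s" using m by linarith
    then have "(4 * real q - 7) ^ 2 \<le> s ^ 2" using q by (intro power_mono) auto
    then have "(2 * real q - 5) ^ 2 + 3 \<le> 0" unfolding s(2)
      by (simp add: power2_eq_square algebra_simps)
    then show False using zero_le_power2[of "2 * real q - 5"] by linarith
  qed
  show "q + 1 < 3 * m"
  proof (rule ccontr)
    assume "\<not> ?thesis"
    then have "real (3 * m) \<le> real (q + 1)" by (subst of_nat_le_iff) simp
    then have "3 * real m \<le> real q + 1" by simp
    then have "s \<le> 2 * real q - 5" using m by linarith
    then have "s ^ 2 \<le> (2 * real q - 5) ^ 2" using s by (intro power_mono) auto
    then have "real q * real q + real q \<le> 8" unfolding s(2)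
      by (simp add: power2_eq_square algebra_simps)
    moreover have "real q * real q \<ge> 3 * 3" using q by (intro mult_mono) auto
    ultimately show False using q by linarith
  qed
  show "m \<ge> 3" if "q \<ge> 4"
  proof -
    have "8 * real q ^ 2 - 16 * real q - 7 = 8 * (real q - 4) * (real q + 2) + 57"
      by (simp add: power2_eq_square algebra_simps)
    \<comment> \<open>More than 5 suffices, as then \<open>6 * m \<ge> 7 + s > 12\<close>.\<close>
    then have "s ^ 2 \<ge> 57" using that s by simp
    then have "s > 5" using power_mono[of s 5 2] s(1) by (cases "s \<le> 5") auto
    then have "real m > 2" using m(1) by simp
    then show ?thesis by simp
  qed
qed

section \<open>Choice of the directions\<close>

theorem theorem11:
  fixes q n :: nat
  assumes "primepow q" and "q \<ge> 3"
    and "CARD('a) = q"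
    and "int n = 3 * \<lceil>(7 + sqrt (8 * real q ^ 2 - 16 * real q - 7)) / 6\<rceil>"
  shows "\<exists>(C :: 'a::{field,finite} vec set) k.
           nkd_code n k 7 C \<and>
           has_locality n 2 C \<and>
           disjoint_repair_groups n 2 C \<and>
           singleton_optimal n k 7 2"
proof -
  define m where "m = n div 3"
  have "3 dvd int n" unfolding assms(4) by simp
  then have n: "n = 3 * m" unfolding m_def by presburger
  then have "int m = \<lceil>(7 + sqrt (8 * real q ^ 2 - 16 * real q - 7)) / 6\<rceil>" using assms(4) by simp
  note m = block_count_bounds[OF assms(2) this]
  \<comment> \<open>The enumeration \<open>e\<close> of the field serves twice: for the affine
    directions and, since \<open>m \<le> q\<close>, for the evaluation points of the outer
    code.\<close>
  obtain e :: "nat \<Rightarrow> 'a" where e: "bij_betw e {..<q} UNIV"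
    using ex_bij_betw_nat_finite[of "UNIV :: 'a set"] assms(3) by (auto simp: lessThan_atLeast0)
  then have e_eq_iff: "e i = e j \<longleftrightarrow> i = j" if "i < q" "j < q" for i j
    using that by (auto simp: bij_betw_def inj_on_def)
  \<comment> \<open>The points \<open>(1, t)\<close> and \<open>(0, 1)\<close> of the projective line, indexed cyclically.\<close>
  define u where "u = (\<lambda>j. if j mod (q + 1) = q then 0 else 1 :: 'a)"
  define v where "v = (\<lambda>j. if j mod (q + 1) = q then 1 else e (j mod (q + 1)))"
  have lt: "j mod (q + 1) \<noteq> q \<Longrightarrow> j mod (q + 1) < q" for j
    using mod_less_divisor[of "q + 1" j] by linarith
  have parallel: "u i * v j = u j * v i \<longleftrightarrow> i mod (q + 1) = j mod (q + 1)" for i j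
    using lt[of i] lt[of j] by (auto simp: u_def v_def e_eq_iff)
  \<comment> \<open>The coordinates fill at most two periods of the cyclic indexing.\<close>
  have same: "i = j \<or> i = j + (q + 1) \<or> j = i + (q + 1)"
    if "i mod (q + 1) = j mod (q + 1)" "i < 3 * m" "j < 3 * m" for i j
  proof -
    have "i div (q + 1) < 2" "j div (q + 1) < 2"
      using that m(2) by (auto intro!: less_mult_imp_div_less)
    then show ?thesis
      using that(1) div_mult_mod_eq[of i "q + 1"] div_mult_mod_eq[of j "q + 1"]
      by (auto simp: less_2_cases_iff)
  qed
  interpret direction_code m e u v
  proof
    show "m \<ge> 2" by (rule m)
    show "inj_on e {..<m}"
      by (rule inj_on_subset[OF bij_betw_imp_inj_on[OF e]]) (use m(2) assms(2) in auto)
    show "u i * v j \<noteq> u j * v i"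
      if "i < 3 * m" "j < 3 * m" "i \<noteq> j" "i div 3 = j div 3" for i j
    proof
      assume "u i * v j = u j * v i"
      then have "i = j + (q + 1) \<or> j = i + (q + 1)" using same[of i j] that parallel by blast
      \<comment> \<open>Equal directions lie \<open>q + 1 \<ge> 4\<close> apart, coordinates of one
        block at most 2.\<close>
      moreover have "i < j + 3" "j < i + 3" using that(4) by linarith+
      ultimately show False using assms(2) by linarith
    qed
    show "u i * v k \<noteq> u k * v i"
      if "i < 3 * m" "j < 3 * m" "k < 3 * m" "i \<noteq> j" "i \<noteq> k" "j \<noteq> k" "u i * v j = u j * v i" for i j k
    proof
      assume "u i * v k = u k * v i"
      then have "i = j + (q + 1) \<or> j = i + (q + 1)" "i = k + (q + 1) \<or> k = i + (q + 1)"
        using same[of i j] same[of i k] that parallel by blast+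
      then show False using that(1-3,6) m(2) by linarith
    qed
  qed
  have "m = 2 \<or> (\<exists>i j. m \<ge> 3 \<and> i < 3 * m \<and> j < 3 * m \<and> i div 3 \<noteq> j div 3 \<and> u i * v j = u j * v i)"
  proof (cases "q = 3")
    case True
    \<comment> \<open>Here \<open>3 * m \<le> 8\<close> and \<open>m \<ge> 2\<close> leave only
      \<open>m = 2\<close>.\<close>
    then show ?thesis using m by linarith
  next
    case False
    then have "m \<ge> 3" using m(4) assms(2) by simp
    \<comment> \<open>Coordinates \<open>0\<close> and \<open>q + 1\<close> are one period apart and
      share a direction; as \<open>q + 1 \<ge> 3\<close> they lie in different blocks.\<close>
    moreover have "0 div 3 \<noteq> (q + 1) div 3" using assms(2) by linarith
    moreover have "u 0 * v (q + 1) = u (q + 1) * v 0" unfolding parallel by simp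
    ultimately show ?thesis using m(3)
      by (intro disjI2 exI[of _ "0::nat"] exI[of _ "q + 1"]) auto
  qed
  then show ?thesis using optimal_code unfolding n by blast
qed

end
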